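(* For every $n\in\mathbb{N}$, $n\ge 1$, the Frobenius average function of the congruent number elliptic curves satisfies \[\lim_{X\to\infty} f_X(n)=0,\qquad\text{where}\qquad f_X(n):=\frac{1}{\#\mathrm{SF}(X)}\sum_{D\in \mathrm{SF}(X)} a_{p_n}(E_D).\] Here $X$ runs over positive integers, $\mathrm{SF}(X)$ is the set of all positive square-free integers less than or equal to $X$, $p_n$ is the $n$-th prime ($p_1=2,\ p_2=3,\ p_3=5,\ldots$), and $a_{p}(E_D)$ is the Frobenius trace at $p$ of the elliptic curve $E_D: y^2=x^3-D^2x$ over $\mathbb{Q}$.
   Context: For a positive square-free integer $D$, $E_D$ denotes the congruent number elliptic curve $y^2=x^3-D^2x$ over $\mathbb{Q}$. For a prime $p$, the Frobenius trace $a_p(E_D)$ is the integer defined by $\#\tilde{E}_D(\mathbb{F}_p)=p+1-a_p(E_D)$, where $\#\tilde{E}_D(\mathbb{F}_p)$ is the number of solutions $(x,y)\in\mathbb{F}_p^2$ of $y^2=x^3-D^2x$, plus one for the point at infinity. The same counting formula is used at the primes $p\mid 2D$ of bad reduction, where it gives $a_p(E_D)=0$. *)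

theory Defs
  imports Complex_Main "HOL-Number_Theory.Number_Theory" "HOL-Computational_Algebra.Squarefree" "HOL-Library.Infinite_Set"
begin

(* The field with p elements is represented by the least non-negative residues 0, ..., p - 1,
   with equality read as congruence modulo p. *)
definition affine_points :: "nat \<Rightarrow> nat \<Rightarrow> (int \<times> int) set" where
  "affine_points D p =
     {(x, y). x \<in> {0..<int p} \<and> y \<in> {0..<int p} \<and>
              [y ^ 2 = x ^ 3 - (int D) ^ 2 * x] (mod int p)}"

(* The affine solutions together with the point at infinity; also used at the bad primes. *)
definition num_points :: "nat \<Rightarrow> nat \<Rightarrow> nat" where
  "num_points D p = card (affine_points D p) + 1"

definition frobenius_trace :: "nat \<Rightarrow> nat \<Rightarrow> int" where
  "frobenius_trace D p = int p + 1 - int (num_points D p)"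

definition SF :: "nat \<Rightarrow> nat set" where
  "SF X = {D. 0 < D \<and> D \<le> X \<and> squarefree D}"

(* enumerate counts from 0, whereas the first prime nth_prime 1 is 2; only n \<ge> 1 is meaningful. *)
definition nth_prime :: "nat \<Rightarrow> nat" where
  "nth_prime n = enumerate {p. prime p} (n - 1)"

definition frobenius_average :: "nat \<Rightarrow> nat \<Rightarrow> real" where
  "frobenius_average X n =
     1 / real (card (SF X)) * (\<Sum>D\<in>SF X. real_of_int (frobenius_trace D (nth_prime n)))"

end

theory Submission
  imports Defs
begin

text \<open>
  Fix a prime \<open>p\<close>. The trace \<open>a\<^sub>p(E\<^sub>D)\<close> depends only on \<open>D\<close> modulo \<open>p\<close>; call it \<open>f(D)\<close>. Two facts
  about \<open>f\<close> suffice: it vanishes at \<open>0\<close>, and its sum over all residues is \<open>0\<close>. Both come from one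
  substitution. A point of \<open>y\<^sup>2 = x\<^sup>3 - t\<^sup>2 x\<close> with \<open>x \<noteq> 0\<close> can be written with \<open>t = x u\<close> and \<open>y = x v\<close>,
  and the equation becomes \<open>v\<^sup>2 = x (1 - u\<^sup>2)\<close>. For every fixed \<open>u\<close> this has exactly \<open>p - 1\<close> solutions
  \<open>(x, v)\<close> with \<open>x \<noteq> 0\<close>. Together with the point \<open>(0, 0)\<close> of each curve, the slice \<open>u = 0\<close>, which is \<open>t = 0\<close>,
  gives \<open>p\<close> points, and all slices together give \<open>p\<^sup>2\<close> points as \<open>t\<close> runs over the residues
  (\<open>card_curve_points_0\<close>, \<open>sum_card_curve_points\<close>).

  To pass to square-free \<open>D\<close>, detect square-freeness by the sum of \<open>\<mu>(d)\<close> over all \<open>d\<close> with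
  \<open>d\<^sup>2\<close> dividing \<open>n\<close>. The sum of \<open>f\<close> over \<open>SF X\<close> becomes a signed sum over \<open>d \<le> \<surd>X\<close> of the sums of \<open>f(d\<^sup>2 k)\<close> over \<open>k \<le> X/d\<^sup>2\<close>. Each of
  these stays bounded independently of \<open>d\<close> and \<open>X\<close>: if \<open>p\<close> divides \<open>d\<close> every term is \<open>f(0) = 0\<close>, and
  otherwise \<open>k \<mapsto> d\<^sup>2 k\<close> permutes the residues, so complete periods cancel. Hence the sum of the
  traces is \<open>O(\<surd>X)\<close> (\<open>abs_sum_SF_le\<close>). Since at least \<open>X/4\<close> of the integers up to \<open>X\<close> are
  square-free (\<open>card_SF_ge\<close>), the average is \<open>O(1/\<surd>X)\<close>.
\<close>

section \<open>Sums over residues\<close>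

lemma sum_residues_mult:
  fixes f :: "int \<Rightarrow> 'b::comm_monoid_add"
  assumes "coprime a m"
    and periodic: "\<And>x y. [x = y] (mod m) \<Longrightarrow> f x = f y"
  shows "(\<Sum>k\<in>{0..<m}. f (a * k)) = (\<Sum>k\<in>{0..<m}. f k)"
proof -
  have inj: "inj_on (\<lambda>k. (a * k) mod m) {0..<m}"
  proof (rule inj_onI)
    fix k l assume kl: "k \<in> {0..<m}" "l \<in> {0..<m}" and eq: "(a * k) mod m = (a * l) mod m"
    from eq have "[a * k = a * l] (mod m)" by (simp add: cong_def)
    hence "[k = l] (mod m)" using assms(1) by (simp add: cong_mult_lcancel)
    thus "k = l" using kl by (simp add: cong_def)
  qed
  have "(\<lambda>k. (a * k) mod m) ` {0..<m} = {0..<m}"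
    by (intro endo_inj_surj inj) auto
  hence "bij_betw (\<lambda>k. (a * k) mod m) {0..<m} {0..<m}"
    using inj by (simp add: bij_betw_def)
  hence "(\<Sum>k\<in>{0..<m}. f ((a * k) mod m)) = (\<Sum>k\<in>{0..<m}. f k)"
    by (rule sum.reindex_bij_betw)
  moreover have "f ((a * k) mod m) = f (a * k)" for k
    by (rule periodic) simp
  ultimately show ?thesis by simp
qed

text \<open>
  Complete periods cancel, and what is left at the end is a sum over distinct residues.
\<close>
lemma abs_partial_sum_periodic_le:
  fixes f :: "int \<Rightarrow> int"
  assumes "m > 0"
    and periodic: "\<And>x y. [x = y] (mod m) \<Longrightarrow> f x = f y"
    and mean_zero: "(\<Sum>k\<in>{0..<m}. f k) = 0"
  shows "\<bar>\<Sum>k\<in>{0..<y}. f k\<bar> \<le> (\<Sum>k\<in>{0..<m}. \<bar>f k\<bar>)"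
proof (induction "nat y" arbitrary: y rule: less_induct)
  case less
  show ?case
  proof (cases "y \<le> m")
    case True
    have "\<bar>\<Sum>k\<in>{0..<y}. f k\<bar> \<le> (\<Sum>k\<in>{0..<y}. \<bar>f k\<bar>)" by (rule sum_abs)
    also have "\<dots> \<le> (\<Sum>k\<in>{0..<m}. \<bar>f k\<bar>)"
      using True by (intro sum_mono2) auto
    finally show ?thesis .
  next
    case False
    have split: "{0..<y} = {0..<m} \<union> {m..<y}" using False \<open>m > 0\<close> by auto
    have "(\<Sum>k\<in>{0..<y}. f k) = (\<Sum>k\<in>{0..<m}. f k) + (\<Sum>k\<in>{m..<y}. f k)"
      unfolding split by (rule sum.union_disjoint) auto
    also have "(\<Sum>k\<in>{m..<y}. f k) = (\<Sum>k\<in>{0..<y - m}. f (k + m))"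
      by (rule sum.reindex_bij_witness[of _ "\<lambda>k. k + m" "\<lambda>k. k - m"]) auto
    also have "\<dots> = (\<Sum>k\<in>{0..<y - m}. f k)"
      by (intro sum.cong refl periodic) (simp add: cong_def)
    finally have "(\<Sum>k\<in>{0..<y}. f k) = (\<Sum>k\<in>{0..<y - m}. f k)"
      using mean_zero by simp
    moreover have "nat (y - m) < nat y" using False \<open>m > 0\<close> by simp
    ultimately show ?thesis using less[of "y - m"] by simp
  qed
qed

text \<open>
  The bound does not depend on \<open>a\<close>, which is what allows the square divisors of square-free
  detection to be summed trivially. The hypothesis \<open>f 0 = 0\<close> covers the multipliers divisible
  by \<open>p\<close>, for which there is no cancellation.
\<close>
lemma abs_sum_multiples_le:
  fixes f :: "int \<Rightarrow> int"
  assumes "prime p"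
    and periodic: "\<And>x y. [x = y] (mod p) \<Longrightarrow> f x = f y"
    and mean_zero: "(\<Sum>k\<in>{0..<p}. f k) = 0" and zero: "f 0 = 0"
  shows "\<bar>\<Sum>k\<in>{1..n}. f (a * int k)\<bar> \<le> (\<Sum>k\<in>{0..<p}. \<bar>f k\<bar>)"
proof (cases "p dvd a")
  case True
  have "f (a * int k) = f 0" for k
    using True by (intro periodic) (simp add: cong_0_iff)
  thus ?thesis using zero by (simp add: sum_nonneg)
next
  case False
  with \<open>prime p\<close> have cop: "coprime a p"
    by (metis coprime_commute prime_imp_coprime)
  have per: "f (a * x) = f (a * y)" if "[x = y] (mod p)" for x y
    using that by (intro periodic cong_mult cong_refl)
  have "(\<Sum>k\<in>{1..n}. f (a * int k)) = (\<Sum>k\<in>{0..<int n + 1} - {0}. f (a * k))"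
    by (rule sum.reindex_bij_witness[of _ nat int]) auto
  also have "\<dots> = (\<Sum>k\<in>{0..<int n + 1}. f (a * k))"
    using zero by (intro sum.mono_neutral_left) auto
  finally have eq: "(\<Sum>k\<in>{1..n}. f (a * int k)) = (\<Sum>k\<in>{0..<int n + 1}. f (a * k))" .
  have "\<bar>\<Sum>k\<in>{0..<int n + 1}. f (a * k)\<bar> \<le> (\<Sum>k\<in>{0..<p}. \<bar>f (a * k)\<bar>)"
  proof (rule abs_partial_sum_periodic_le)
    show "p > 0" using \<open>prime p\<close> by (simp add: prime_gt_0_int)
    show "(\<Sum>k\<in>{0..<p}. f (a * k)) = 0"
      using sum_residues_mult[OF cop, of f] periodic mean_zero by simp
  qed (rule per)
  also have "\<dots> = (\<Sum>k\<in>{0..<p}. \<bar>f k\<bar>)"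
    using periodic by (intro sum_residues_mult cop) (metis periodic)
  finally show ?thesis using eq by simp
qed

section \<open>Square-free numbers\<close>

definition mobius :: "nat \<Rightarrow> int" where
  "mobius d = (if squarefree d then (-1) ^ card (prime_factors d) else 0)"

lemma abs_mobius_le_1: "\<bar>mobius d\<bar> \<le> 1"
  by (simp add: mobius_def power_abs)

lemma prod_prime_factors_squarefree:
  fixes d :: nat
  assumes "squarefree d"
  shows "\<Prod>(prime_factors d) = d"
proof -
  have "d > 0" using assms by (cases d) auto
  have "d = (\<Prod>p\<in>prime_factors d. p ^ multiplicity p d)"
    by (rule prime_factorization_nat) fact
  also have "\<dots> = (\<Prod>p\<in>prime_factors d. p)"
    using assms \<open>d > 0\<close> by (intro prod.cong refl) (simp add: squarefree_factorial_semiring')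
  finally show ?thesis by simp
qed

text \<open>
  The inverse map is the product. Through this bijection a sum of the Moebius function over divisors
  becomes an alternating sum over subsets.
\<close>
lemma bij_betw_squarefree_divisors:
  fixes m :: nat
  assumes "m > 0"
  shows "bij_betw prime_factors {d. d dvd m \<and> squarefree d} (Pow (prime_factors m))"
proof (rule bij_betw_byWitness[where f' = "\<lambda>S. \<Prod>S"])
  have S: "finite S" "\<And>q. q \<in> S \<Longrightarrow> prime q" if "S \<subseteq> prime_factors m" for S
    using that by (auto intro: finite_subset)
  show "\<forall>d\<in>{d. d dvd m \<and> squarefree d}. \<Prod>(prime_factors d) = d"
    by (simp add: prod_prime_factors_squarefree)
  show "\<forall>S\<in>Pow (prime_factors m). prime_factors (\<Prod>S) = S"
  proof safe
    fix S x assume sub: "S \<subseteq> prime_factors m"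
    have "0 \<notin> S" using S(2)[OF sub, of 0] by auto
    hence *: "prime_factors (\<Prod>S) = (\<Union>q\<in>S. prime_factors q)"
      using prime_factors_prod[OF S(1)[OF sub], of "\<lambda>x. x"] by (simp add: o_def)
    have "\<dots> = (\<Union>q\<in>S. {q})"
      using S(2)[OF sub] by (intro SUP_cong refl) (simp add: prime_prime_factors)
    with * have "prime_factors (\<Prod>S) = S" by simp
    thus "x \<in># prime_factorization (\<Prod>S) \<Longrightarrow> x \<in> S" 
      "x \<in> S \<Longrightarrow> x \<in># prime_factorization (\<Prod>S)" by auto
  qed
  show "prime_factors ` {d. d dvd m \<and> squarefree d} \<subseteq> Pow (prime_factors m)"
    using assms by (auto dest: dvd_prime_factors[rotated])
  show "(\<lambda>S. \<Prod>S) ` Pow (prime_factors m) \<subseteq> {d. d dvd m \<and> squarefree d}"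
  proof safe
    fix S assume sub: "S \<subseteq> prime_factors m"
    have "\<Prod>S dvd \<Prod>(prime_factors m)"
      using sub by (intro prod_dvd_prod_subset) auto
    also have "\<dots> dvd (\<Prod>p\<in>prime_factors m. p ^ multiplicity p m)"
      by (intro prod_dvd_prod dvd_power) (auto simp: prime_factors_multiplicity)
    also have "\<dots> = m" by (rule prime_factorization_nat[symmetric]) fact
    finally show "\<Prod>S dvd m" .
    show "squarefree (\<Prod>S)"
      using S(2)[OF sub]
      by (intro squarefree_prod_coprime) (auto intro: primes_coprime squarefree_prime)
  qed
qed

lemma sum_mobius_divisors:
  assumes "m > 0"
  shows "(\<Sum>d | d dvd m. mobius d) = of_bool (m = 1)"
proof -
  have "(\<Sum>d | d dvd m. mobius d) = (\<Sum>d | d dvd m \<and> squarefree d. mobius d)"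
    using assms by (intro sum.mono_neutral_right) (auto simp: mobius_def)
  also have "\<dots> = (\<Sum>d | d dvd m \<and> squarefree d. (-1) ^ card (prime_factors d))"
    by (intro sum.cong) (auto simp: mobius_def)
  also have "\<dots> = (\<Sum>S\<in>Pow (prime_factors m). (-1) ^ card S)"
    by (rule sum.reindex_bij_betw[OF bij_betw_squarefree_divisors[OF assms]])
  \<comment> \<open>Expanding this product of zeros over subsets gives back the alternating sum.\<close>
  also have "\<dots> = (\<Prod>p\<in>prime_factors m. (-1) + 1)"
    by (subst prod_add) auto
  also have "\<dots> = of_bool (m = 1)"
    using assms by (auto simp: power_0_left prime_factorization_empty_iff)
  finally show ?thesis .
qed

text \<open>
  The \<open>d\<close> with \<open>d\<^sup>2\<close> dividing \<open>n\<close> are the divisors of the largest such \<open>d\<close>, the square part of \<open>n\<close>,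
  so this is the divisor sum of the Moebius function at the square part.
\<close>
lemma sum_mobius_square_divisors:
  assumes "n > 0"
  shows "(\<Sum>d | d\<^sup>2 dvd n. mobius d) = of_bool (squarefree n)"
proof -
  have "square_part n > 0" using assms by (intro Nat.gr0I) simp
  hence "(\<Sum>d | d\<^sup>2 dvd n. mobius d) = of_bool (square_part n = 1)"
    using sum_mobius_divisors[of "square_part n"] by (simp add: dvd_square_part_iff)
  also have "square_part n = 1 \<longleftrightarrow> squarefree n"
    by (metis assms dvd_square_part_iff nat_dvd_1_iff_1 dvd_refl squarefree_def square_part_square_dvd)
  finally show ?thesis .
qed

lemma card_square_le: "real (card {d. 1 \<le> d \<and> d\<^sup>2 \<le> X}) \<le> sqrt (real X)" for X :: nat
proof -
  have "{d. 1 \<le> d \<and> d\<^sup>2 \<le> X} \<subseteq> {1..nat \<lfloor>sqrt (real X)\<rfloor>}"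
  proof safe
    fix d :: nat assume "1 \<le> d" "d\<^sup>2 \<le> X"
    hence "real d \<le> sqrt (real X)"
      by (metis of_nat_le_iff of_nat_power real_le_rsqrt)
    thus "d \<in> {1..nat \<lfloor>sqrt (real X)\<rfloor>}" using \<open>1 \<le> d\<close> by (simp add: le_nat_floor)
  qed
  hence "card {d. 1 \<le> d \<and> d\<^sup>2 \<le> X} \<le> nat \<lfloor>sqrt (real X)\<rfloor>"
    by (metis card_atLeastAtMost card_mono diff_Suc_1 finite_atLeastAtMost)
  thus ?thesis by (meson le_nat_floor of_nat_floor of_nat_mono order_trans real_sqrt_ge_zero of_nat_0_le_iff)
qed

text \<open>
  Moebius inversion over square divisors leaves at most \<open>\<surd>X\<close> inner sums, one for each \<open>d\<close>, of
  \<open>f\<close> along the multiples of \<open>d\<^sup>2\<close>, and each of them is bounded by the same constant.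
\<close>
lemma abs_sum_SF_le:
  fixes f :: "int \<Rightarrow> int"
  assumes "prime p"
    and periodic: "\<And>x y. [x = y] (mod p) \<Longrightarrow> f x = f y"
    and mean_zero: "(\<Sum>k\<in>{0..<p}. f k) = 0" and zero: "f 0 = 0"
  shows "\<bar>real_of_int (\<Sum>D\<in>SF X. f (int D))\<bar> \<le> (\<Sum>k\<in>{0..<p}. \<bar>f k\<bar>) * sqrt (real X)"
proof -
  define B where "B = (\<Sum>k\<in>{0..<p}. \<bar>f k\<bar>)"
  define R where "R = {d. 1 \<le> d \<and> d\<^sup>2 \<le> X}"
  have "R \<subseteq> {..X}"
    unfolding R_def by (auto intro: order_trans[OF power2_nat_le_imp_le] dest: power2_nat_le_imp_le)
  hence [simp]: "finite R" by (rule finite_subset) simp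
  have [simp]: "B \<ge> 0" by (simp add: B_def sum_nonneg)
  have "(\<Sum>D\<in>SF X. f (int D)) = (\<Sum>n\<in>{1..X}. of_bool (squarefree n) * f (int n))"
    by (rule sum.mono_neutral_cong_left) (auto simp: SF_def)
  also have "\<dots> = (\<Sum>n\<in>{1..X}. \<Sum>d | d \<in> R \<and> d\<^sup>2 dvd n. mobius d * f (int n))"
  proof (rule sum.cong[OF refl])
    fix n assume n: "n \<in> {1..X}"
    have "d \<in> R" if "d\<^sup>2 dvd n" for d
    proof -
      have "d \<noteq> 0" using that n by (intro notI) auto
      moreover have "d\<^sup>2 \<le> n" using that n by (intro dvd_imp_le) auto
      ultimately show ?thesis using n by (simp add: R_def Suc_le_eq)
    qed
    hence "{d. d\<^sup>2 dvd n} = {d. d \<in> R \<and> d\<^sup>2 dvd n}" by auto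
    thus "of_bool (squarefree n) * f (int n) = (\<Sum>d | d \<in> R \<and> d\<^sup>2 dvd n. mobius d * f (int n))"
      using n sum_mobius_square_divisors[of n] by (simp flip: sum_distrib_right)
  qed
  also have "\<dots> = (\<Sum>d\<in>R. \<Sum>n | n \<in> {1..X} \<and> d\<^sup>2 dvd n. mobius d * f (int n))"
    by (rule sum.swap_restrict) auto
  also have "\<dots> = (\<Sum>d\<in>R. mobius d * (\<Sum>k\<in>{1..X div d\<^sup>2}. f (int (d\<^sup>2) * int k)))"
  proof (rule sum.cong[OF refl])
    fix d assume "d \<in> R"
    hence d: "d\<^sup>2 > 0" by (simp add: R_def)
    have "(\<Sum>n | n \<in> {1..X} \<and> d\<^sup>2 dvd n. f (int n)) = (\<Sum>k\<in>{1..X div d\<^sup>2}. f (int (d\<^sup>2) * int k))"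
      using d
      by (intro sum.reindex_bij_witness[of _ "\<lambda>k. d\<^sup>2 * k" "\<lambda>n. n div d\<^sup>2"])
         (auto simp: less_eq_div_iff_mult_less_eq mult.commute div_le_mono Suc_le_eq div_greater_zero_iff dvd_imp_le)
    thus "(\<Sum>n | n \<in> {1..X} \<and> d\<^sup>2 dvd n. mobius d * f (int n)) =
        mobius d * (\<Sum>k\<in>{1..X div d\<^sup>2}. f (int (d\<^sup>2) * int k))"
      by (simp flip: sum_distrib_left)
  qed
  finally have "\<bar>\<Sum>D\<in>SF X. f (int D)\<bar> \<le>
      (\<Sum>d\<in>R. \<bar>mobius d * (\<Sum>k\<in>{1..X div d\<^sup>2}. f (int (d\<^sup>2) * int k))\<bar>)"
    by (simp only: sum_abs)
  also have "\<dots> \<le> (\<Sum>d\<in>R. B)"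
  proof (rule sum_mono)
    fix d assume "d \<in> R"
    have "\<bar>mobius d\<bar> * \<bar>\<Sum>k\<in>{1..X div d\<^sup>2}. f (int (d\<^sup>2) * int k)\<bar> \<le> 1 * B"
      unfolding B_def using abs_mobius_le_1
      by (intro mult_mono abs_sum_multiples_le assms) auto
    thus "\<bar>mobius d * (\<Sum>k\<in>{1..X div d\<^sup>2}. f (int (d\<^sup>2) * int k))\<bar> \<le> B"
      by (simp add: abs_mult)
  qed
  also have "\<dots> = B * int (card R)" by simp
  finally have "real_of_int \<bar>\<Sum>D\<in>SF X. f (int D)\<bar> \<le> real_of_int (B * int (card R))"
    by (simp only: of_int_le_iff)
  also have "\<dots> \<le> real_of_int B * sqrt (real X)"
    using card_square_le[of X] by (simp add: R_def mult_left_mono)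
  finally show ?thesis by (simp add: B_def)
qed

text \<open>
  The term \<open>d = 2\<close> is \<open>1/4\<close>, and the others are bounded by the telescoping differences
  \<open>1/(d - 1) - 1/d\<close>, which add up to at most \<open>1/2\<close>. Any constant below \<open>1\<close> would serve.
\<close>
lemma sum_inverse_squares_le: "(\<Sum>d\<in>{2..n}. 1 / (real d)\<^sup>2) \<le> 3/4"
proof -
  have "n \<ge> 2 \<Longrightarrow> (\<Sum>d\<in>{2..n}. 1 / (real d)\<^sup>2) \<le> 3/4 - 1 / n"
  proof (induction n rule: dec_induct)
    case (step n)
    have "1 / (real (Suc n))\<^sup>2 \<le> 1 / (real n * real (Suc n))"
      using step(1) by (intro divide_left_mono) (auto simp: power2_eq_square)
    also have "\<dots> = 1 / n - 1 / real (Suc n)"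
      using step(1) by (simp add: field_simps)
    finally have "1 / (real (Suc n))\<^sup>2 \<le> 1 / n - 1 / real (Suc n)" .
    with step show ?case by simp
  qed auto
  moreover have "3/4 - 1 / real n \<le> 3/4" by simp
  ultimately show ?thesis by (cases "n \<ge> 2") (blast intro: order_trans, simp)
qed

text \<open>
  A number that is not square-free is divisible by some \<open>d\<^sup>2\<close> with \<open>d \<ge> 2\<close>, so by the union bound there
  are at most \<open>\<Sum> X/d\<^sup>2 \<le> 3X/4\<close> of them.
\<close>
lemma card_SF_ge: "real (card (SF X)) \<ge> real X / 4"
proof -
  have "{1..X} \<subseteq> SF X \<union> (\<Union>d\<in>{2..X}. {n\<in>{1..X}. d\<^sup>2 dvd n})"
  proof
    fix n assume n: "n \<in> {1..X}"
    show "n \<in> SF X \<union> (\<Union>d\<in>{2..X}. {n\<in>{1..X}. d\<^sup>2 dvd n})"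
    proof (cases "squarefree n")
      case False
      then obtain d where d: "d\<^sup>2 dvd n" "d \<noteq> 1" by (auto elim: not_squarefreeE)
      moreover have "d \<noteq> 0" using d n by (intro notI) auto
      moreover have "d\<^sup>2 \<le> n" using d n by (intro dvd_imp_le) auto
      hence "d \<le> n" by (rule power2_nat_le_imp_le)
      ultimately show ?thesis using n by auto
    qed (use n in \<open>auto simp: SF_def\<close>)
  qed
  hence "card {1..X} \<le> card (SF X \<union> (\<Union>d\<in>{2..X}. {n\<in>{1..X}. d\<^sup>2 dvd n}))"
    by (intro card_mono) (auto simp: SF_def)
  also have "\<dots> \<le> card (SF X) + card (\<Union>d\<in>{2..X}. {n\<in>{1..X}. d\<^sup>2 dvd n})"
    by (rule card_Un_le)
  also have "card (\<Union>d\<in>{2..X}. {n\<in>{1..X}. d\<^sup>2 dvd n}) \<le> (\<Sum>d\<in>{2..X}. card {n\<in>{1..X}. d\<^sup>2 dvd n})"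
    by (rule card_UN_le) simp
  also have "\<dots> \<le> (\<Sum>d\<in>{2..X}. X div d\<^sup>2)"
  proof (rule sum_mono)
    fix d assume "d \<in> {2..X}"
    hence "{n\<in>{1..X}. d\<^sup>2 dvd n} \<subseteq> (\<lambda>k. d\<^sup>2 * k) ` {1..X div d\<^sup>2}"
      by (auto simp: less_eq_div_iff_mult_less_eq mult.commute elim!: dvdE intro!: imageI)
    hence "card {n\<in>{1..X}. d\<^sup>2 dvd n} \<le> card {1..X div d\<^sup>2}"
      by (rule surj_card_le[rotated]) simp
    thus "card {n\<in>{1..X}. d\<^sup>2 dvd n} \<le> X div d\<^sup>2" by simp
  qed
  finally have "real X \<le> real (card (SF X)) + (\<Sum>d\<in>{2..X}. real (X div d\<^sup>2))"
    by (simp flip: of_nat_sum of_nat_add)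
  also have "(\<Sum>d\<in>{2..X}. real (X div d\<^sup>2)) \<le> (\<Sum>d\<in>{2..X}. real X * (1 / (real d)\<^sup>2))"
    by (intro sum_mono) (use of_nat_div_le_of_nat[where 'a = real, of X] in \<open>simp flip: of_nat_power\<close>)
  also have "\<dots> \<le> real X * (3/4)"
    unfolding sum_distrib_left[symmetric] by (intro mult_left_mono sum_inverse_squares_le) simp
  finally show ?thesis by simp
qed

section \<open>Counting points in the family\<close>

text \<open>
  The parameter ranges over the integers here, so that it can be scaled and summed over residues.
\<close>
definition curve_points :: "int \<Rightarrow> int \<Rightarrow> (int \<times> int) set" where
  "curve_points p t = {(x, y). x \<in> {0..<p} \<and> y \<in> {0..<p} \<and> [y\<^sup>2 = x ^ 3 - t\<^sup>2 * x] (mod p)}"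

definition on_curve :: "int \<Rightarrow> int \<Rightarrow> int \<Rightarrow> int \<Rightarrow> int" where
  "on_curve p t x y = of_bool (p dvd y\<^sup>2 - (x ^ 3 - t\<^sup>2 * x))"

lemma on_curve_cong:
  assumes "[t = t'] (mod p)" "[x = x'] (mod p)" "[y = y'] (mod p)"
  shows "on_curve p t x y = on_curve p t' x' y'"
proof -
  have "[y\<^sup>2 - (x ^ 3 - t\<^sup>2 * x) = y'\<^sup>2 - (x' ^ 3 - t'\<^sup>2 * x')] (mod p)"
    by (intro cong_diff cong_mult cong_pow assms)
  thus ?thesis by (simp add: on_curve_def cong_dvd_iff)
qed

lemma card_curve_points:
  "int (card (curve_points p t)) = (\<Sum>x\<in>{0..<p}. \<Sum>y\<in>{0..<p}. on_curve p t x y)"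
proof -
  have "curve_points p t = (SIGMA x:{0..<p}. {0..<p} \<inter> {y. p dvd y\<^sup>2 - (x ^ 3 - t\<^sup>2 * x)})"
    by (auto simp: curve_points_def cong_iff_dvd_diff)
  thus ?thesis by (simp add: on_curve_def)
qed

lemma dvd_residue_iff: "p dvd x \<longleftrightarrow> x = 0" if "x \<in> {0..<p}" for x p :: int
  using that by (auto dest: zdvd_imp_le)

text \<open>
  If \<open>c\<close> is invertible modulo \<open>p\<close>, then \<open>x\<close> is determined by \<open>v\<close>, and it is nonzero exactly when \<open>v\<close>
  is. If \<open>p\<close> divides \<open>c\<close>, then \<open>v\<close> must be \<open>0\<close> and every nonzero \<open>x\<close> is a solution. Both cases
  give \<open>p - 1\<close> solutions.
\<close>
lemma sum_scaled_conic:
  fixes p c :: int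
  assumes "prime p"
  shows "(\<Sum>x\<in>{0..<p} - {0}. \<Sum>v\<in>{0..<p}. of_bool (p dvd v\<^sup>2 - x * c)) = p - 1"
proof -
  have p: "p > 0" using assms by (simp add: prime_gt_0_int)
  have sq: "p dvd v\<^sup>2 \<longleftrightarrow> v = 0" if "v \<in> {0..<p}" for v
    using assms dvd_residue_iff[OF that] by (simp add: prime_dvd_power_iff)
  have one: "(\<Sum>v\<in>{0..<p}. of_bool (v = 0)) = (1::int)"
    using p by (simp add: of_bool_def)
  show ?thesis
  proof (cases "p dvd c")
    case True
    have "(\<Sum>v\<in>{0..<p}. of_bool (p dvd v\<^sup>2 - x * c)) = (1::int)" for x
    proof -
      have "(\<Sum>v\<in>{0..<p}. of_bool (p dvd v\<^sup>2 - x * c)) = (\<Sum>v\<in>{0..<p}. of_bool (v = 0) :: int)"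
        using True by (intro sum.cong refl) (simp add: sq dvd_diff_left_iff)
      thus ?thesis using one by simp
    qed
    thus ?thesis using p by simp
  next
    case False
    with assms have cop: "coprime c p" by (metis coprime_commute prime_imp_coprime)
    have "(\<Sum>x\<in>{0..<p} - {0}. of_bool (p dvd v\<^sup>2 - x * c)) = 1 - (of_bool (v = 0) :: int)"
      if v: "v \<in> {0..<p}" for v
    proof -
      have "(\<Sum>x\<in>{0..<p}. of_bool (p dvd v\<^sup>2 - c * x)) = (\<Sum>x\<in>{0..<p}. of_bool (p dvd v\<^sup>2 - x) :: int)"
      proof (rule sum_residues_mult[OF cop])
        fix x y assume "[x = y] (mod p)"
        hence "[v\<^sup>2 - x = v\<^sup>2 - y] (mod p)" by (intro cong_diff cong_refl)
        thus "of_bool (p dvd v\<^sup>2 - x) = (of_bool (p dvd v\<^sup>2 - y) :: int)"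
          by (simp add: cong_dvd_iff)
      qed
      also have "\<dots> = (\<Sum>x\<in>{0..<p}. of_bool (x = v\<^sup>2 mod p))"
        by (intro sum.cong refl) (auto simp: mod_eq_dvd_iff[symmetric])
      also have "\<dots> = 1" using p by (simp add: of_bool_def)
      finally have "(\<Sum>x\<in>{0..<p}. of_bool (p dvd v\<^sup>2 - x * c)) = (1::int)"
        by (simp add: mult.commute)
      thus ?thesis using p by (subst sum_diff1) (auto simp: sq[OF v])
    qed
    hence "(\<Sum>v\<in>{0..<p}. \<Sum>x\<in>{0..<p} - {0}. of_bool (p dvd v\<^sup>2 - x * c)) = p - 1"
      using p one by (simp add: sum_subtractf)
    thus ?thesis by (subst sum.swap)
  qed
qed

text \<open>
  Substituting \<open>y = x v\<close> turns the cubic with parameter \<open>x u\<close> into \<open>x\<^sup>2\<close> times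
  \<open>v\<^sup>2 - x (1 - u\<^sup>2)\<close>. The factor \<open>x\<^sup>2\<close> is invertible modulo \<open>p\<close>, and the other one is linear
  in \<open>x\<close>, which makes its zeros easy to count.
\<close>
lemma sum_on_curve_scaled:
  fixes p u :: int
  assumes "prime p"
  shows "(\<Sum>x\<in>{0..<p} - {0}. \<Sum>y\<in>{0..<p}. on_curve p (x * u) x y) = p - 1"
proof -
  have "(\<Sum>y\<in>{0..<p}. on_curve p (x * u) x y) =
        (\<Sum>v\<in>{0..<p}. of_bool (p dvd v\<^sup>2 - x * (1 - u\<^sup>2)))" if x: "x \<in> {0..<p} - {0}" for x
  proof -
    have ndvd: "\<not> p dvd x" using x by (simp add: dvd_residue_iff)
    with assms have cop: "coprime x p" by (metis coprime_commute prime_imp_coprime)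
    have "(\<Sum>y\<in>{0..<p}. on_curve p (x * u) x y) = (\<Sum>v\<in>{0..<p}. on_curve p (x * u) x (x * v))"
      by (rule sum_residues_mult[OF cop, symmetric]) (intro on_curve_cong cong_refl)
    also have "\<dots> = (\<Sum>v\<in>{0..<p}. of_bool (p dvd v\<^sup>2 - x * (1 - u\<^sup>2)))"
    proof (rule sum.cong[OF refl])
      fix v
      have "(x * v)\<^sup>2 - (x ^ 3 - (x * u)\<^sup>2 * x) = x\<^sup>2 * (v\<^sup>2 - x * (1 - u\<^sup>2))"
        by (simp add: algebra_simps power2_eq_square power3_eq_cube)
      thus "on_curve p (x * u) x (x * v) = of_bool (p dvd v\<^sup>2 - x * (1 - u\<^sup>2))"
        using assms ndvd by (simp add: on_curve_def prime_dvd_mult_iff prime_dvd_power_iff)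
    qed
    finally show ?thesis .
  qed
  hence "(\<Sum>x\<in>{0..<p} - {0}. \<Sum>y\<in>{0..<p}. on_curve p (x * u) x y) =
         (\<Sum>x\<in>{0..<p} - {0}. \<Sum>v\<in>{0..<p}. of_bool (p dvd v\<^sup>2 - x * (1 - u\<^sup>2)))"
    by (rule sum.cong[OF refl])
  thus ?thesis using sum_scaled_conic[OF assms] by simp
qed

lemma sum_on_curve_x_0:
  fixes p :: int
  assumes "prime p"
  shows "(\<Sum>y\<in>{0..<p}. on_curve p t 0 y) = 1"
proof -
  have "(\<Sum>y\<in>{0..<p}. on_curve p t 0 y) = (\<Sum>y\<in>{0..<p}. of_bool (y = 0))"
    using assms by (intro sum.cong refl) (simp add: on_curve_def prime_dvd_power_iff dvd_residue_iff)
  thus ?thesis using assms by (simp add: of_bool_def prime_gt_0_int)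
qed

lemma card_curve_points_0:
  assumes "prime p"
  shows "int (card (curve_points p 0)) = p"
proof -
  have p: "p > 0" using assms by (simp add: prime_gt_0_int)
  show ?thesis
    using p sum_on_curve_scaled[OF assms, of 0] sum_on_curve_x_0[OF assms, of 0]
    by (simp add: card_curve_points sum.remove[of "{0..<p}" 0])
qed

text \<open>
  For fixed \<open>x \<noteq> 0\<close> the parameter \<open>t\<close> can be replaced by \<open>x u\<close>, because multiplication by \<open>x\<close> permutes
  the residues. After this replacement each \<open>u\<close> contributes \<open>p - 1\<close>; the line \<open>x = 0\<close> contributes
  one point for each \<open>t\<close>.
\<close>
lemma sum_card_curve_points:
  assumes "prime p"
  shows "(\<Sum>t\<in>{0..<p}. int (card (curve_points p t))) = p * p"
proof -
  have p: "p > 0" using assms by (simp add: prime_gt_0_int)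
  have scale: "(\<Sum>t\<in>{0..<p}. \<Sum>y\<in>{0..<p}. on_curve p t x y) =
      (\<Sum>u\<in>{0..<p}. \<Sum>y\<in>{0..<p}. on_curve p (x * u) x y)" if x: "x \<in> {0..<p} - {0}" for x
  proof (rule sum_residues_mult[symmetric])
    show "coprime x p"
      using assms x by (metis DiffE coprime_commute dvd_residue_iff insertI1 prime_imp_coprime)
  qed (intro sum.cong on_curve_cong cong_refl refl)
  have "(\<Sum>t\<in>{0..<p}. int (card (curve_points p t))) =
      (\<Sum>x\<in>{0..<p}. \<Sum>t\<in>{0..<p}. \<Sum>y\<in>{0..<p}. on_curve p t x y)"
    unfolding card_curve_points by (rule sum.swap)
  also have "\<dots> = (\<Sum>t\<in>{0..<p}. \<Sum>y\<in>{0..<p}. on_curve p t 0 y) +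
      (\<Sum>x\<in>{0..<p} - {0}. \<Sum>t\<in>{0..<p}. \<Sum>y\<in>{0..<p}. on_curve p t x y)"
    using p by (intro sum.remove) auto
  also have "(\<Sum>x\<in>{0..<p} - {0}. \<Sum>t\<in>{0..<p}. \<Sum>y\<in>{0..<p}. on_curve p t x y) =
      (\<Sum>u\<in>{0..<p}. \<Sum>x\<in>{0..<p} - {0}. \<Sum>y\<in>{0..<p}. on_curve p (x * u) x y)"
    by (subst sum.swap) (intro sum.cong refl scale)
  also have "\<dots> = p * (p - 1)" using p sum_on_curve_scaled[OF assms] by simp
  also have "(\<Sum>t\<in>{0..<p}. \<Sum>y\<in>{0..<p}. on_curve p t 0 y) = p"
    using p sum_on_curve_x_0[OF assms] by simp
  finally show ?thesis by (simp add: algebra_simps)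
qed

section \<open>The Frobenius average\<close>

lemma frobenius_trace_eq: "frobenius_trace D p = int p - int (card (curve_points (int p) (int D)))"
  by (simp add: frobenius_trace_def num_points_def affine_points_def curve_points_def)

lemma abs_sum_frobenius_trace_SF_le:
  assumes "prime p"
  obtains B :: real where
    "\<And>X. \<bar>\<Sum>D\<in>SF X. real_of_int (frobenius_trace D p)\<bar> \<le> B * sqrt (real X)"
proof -
  define f where "f = (\<lambda>t. int p - int (card (curve_points (int p) t)))"
  have p: "prime (int p)" using assms by simp
  have "f x = f y" if "[x = y] (mod int p)" for x y
    using that unfolding f_def card_curve_points
    by (intro arg_cong2[where f = "(-)"] sum.cong on_curve_cong cong_refl refl)
  moreover have "f 0 = 0" using card_curve_points_0[OF p] by (simp add: f_def)
  moreover have "(\<Sum>t\<in>{0..<int p}. f t) = 0"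
    using sum_card_curve_points[OF p] by (simp add: f_def sum_subtractf)
  ultimately have "\<bar>real_of_int (\<Sum>D\<in>SF X. f (int D))\<bar> \<le> (\<Sum>k\<in>{0..<int p}. \<bar>f k\<bar>) * sqrt (real X)" for X
    by (intro abs_sum_SF_le[OF p])
  thus ?thesis by (intro that) (simp add: f_def frobenius_trace_eq)
qed

theorem theorem5p3:
  fixes n :: nat
  assumes "n \<ge> 1"
  shows "(\<lambda>X. frobenius_average X n) \<longlonglongrightarrow> 0"
proof -
  define p where "p = nth_prime n"
  have "prime p"
    using enumerate_in_set[OF primes_infinite] by (simp add: p_def nth_prime_def)
  then obtain B :: real where
    B: "\<And>X. \<bar>\<Sum>D\<in>SF X. real_of_int (frobenius_trace D p)\<bar> \<le> B * sqrt (real X)"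
    using abs_sum_frobenius_trace_SF_le by blast
  have "\<bar>frobenius_average X n\<bar> \<le> 4 * B / sqrt (real X)" if "X > 0" for X
  proof -
    have "\<bar>frobenius_average X n\<bar> =
        \<bar>\<Sum>D\<in>SF X. real_of_int (frobenius_trace D p)\<bar> / real (card (SF X))"
      by (simp add: frobenius_average_def p_def abs_mult)
    also have "\<dots> \<le> (B * sqrt (real X)) / (real X / 4)"
      using B[of X] card_SF_ge[of X] that by (intro frac_le) auto
    also have "\<dots> = 4 * B / sqrt (real X)"
      using that by (simp add: field_simps flip: real_sqrt_mult)
    finally show ?thesis .
  qed
  hence upper: "eventually (\<lambda>X. \<bar>frobenius_average X n\<bar> \<le> 4 * B / sqrt (real X)) sequentially"
    by (intro eventually_sequentiallyI[of 1]) auto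
  have lower: "eventually (\<lambda>X. 0 \<le> \<bar>frobenius_average X n\<bar>) sequentially" by simp
  have "(\<lambda>X. 4 * B / sqrt (real X)) \<longlonglongrightarrow> 0"
    by (intro tendsto_divide_0[OF tendsto_const] filterlim_at_top_imp_at_infinity
        filterlim_compose[OF sqrt_at_top filterlim_real_sequentially])
  hence "(\<lambda>X. \<bar>frobenius_average X n\<bar>) \<longlonglongrightarrow> 0"
    by (rule tendsto_sandwich[OF lower upper tendsto_const])
  thus ?thesis by (rule tendsto_rabs_zero_cancel)
qed

end
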